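(* Let $t_1>t_0\geq 0$, $x_{\max}>x_{\min}\geq 0$, $G\in C^0([t_0,t_1];(0,+\infty))$, $\psi_0\in H^1(x_{\min},x_{\max})$ and $u\in H^1(t_0,t_1)$ with $u(t_0)=\psi_0(x_{\min})$. Let $\lambda<0$ be a real number, and let $\mathcal{T}_\lambda:C^1([t_0,t_1];L^2(x_{\min},x_{\max}))\to C^1([t_0,t_1])$ be the functional defined by $$\mathcal{T}_\lambda(\psi)(t)=\int_{x_{\min}}^{x_{\max}}a(t,x)\,\psi(t,x)\,dx,$$ where $a$ is the solution of $$\begin{cases}\partial_t a(t,x)+G(t)\,\partial_x a(t,x)=\lambda a(t,x)+x^3 & t\in(t_0,t_1),\ x\in(x_{\min},x_{\max}),\\ a(t_0,x)=0 & x\in[x_{\min},x_{\max}],\\ a(t,x_{\min})=0 & t\in[t_0,t_1].\end{cases}$$ Let $\psi$ be the solution of $$\begin{cases}\partial_t\psi(t,x)=-G(t)\,\partial_x\psi(t,x) & t\in(t_0,t_1),\ x\in(x_{\min},x_{\max}),\\ \psi(t_0,x)=\psi_0(x) & x\in[x_{\min},x_{\max}],\\ \psi(t,x_{\min})=u(t) & t\in[t_0,t_1],\end{cases}$$ and assume that $\psi(t,x_{\max})=0$ for all $t\in[t_0,t_1]$. Let $y(t)=\int_{x_{\min}}^{x_{\max}}\psi(t,x)\,x^3\,dx$, let $z_0\in\mathbb{R}$, and let $z$ be the solution on $[t_0,t_1]$ of $\dot z(t)=\lambda z(t)+y(t)$ with $z(t_0)=z_0$. Then for all $t\in[t_0,t_1]$,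 $$\mathcal{T}_\lambda(\psi)(t)-z(t)=\exp\big(\lambda(t-t_0)\big)\left(\mathcal{T}_\lambda(\psi)(t_0)-z_0\right).$$
   Context: Solutions $\psi$ and $a$ of the transport equations are understood as the unique solutions in $C^0([t_0,t_1];H^1(x_{\min},x_{\max}))\cap C^1([t_0,t_1];L^2(x_{\min},x_{\max}))$. *)

theory Defs
  imports "HOL-Analysis.Analysis"
begin

text \<open>Elements of $L^2(a,b)$ and $H^1(a,b)$ are represented by functions on the whole line; only
  their values on the open interval matter, and only up to null sets. Accordingly
  \<open>L2_norm\<close> is a seminorm on representatives, and \<open>weak_deriv\<close> and \<open>time_deriv\<close> below pick one
  representative of a class that is unique almost everywhere.\<close>

definition L2 :: "real \<Rightarrow> real \<Rightarrow> (real \<Rightarrow> real) set" where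
  "L2 a b = {f \<in> borel_measurable (lebesgue_on {a<..<b}).
               integrable (lebesgue_on {a<..<b}) (\<lambda>x. (f x)\<^sup>2)}"

definition L2_norm :: "real \<Rightarrow> real \<Rightarrow> (real \<Rightarrow> real) \<Rightarrow> real" where
  "L2_norm a b f = sqrt (LINT x|lebesgue_on {a<..<b}. (f x)\<^sup>2)"

text \<open>The space $C_c^\infty(a,b)$.\<close>

definition test_functions :: "real \<Rightarrow> real \<Rightarrow> (real \<Rightarrow> real) set" where
  "test_functions a b =
     {\<phi>. (\<forall>n x. (deriv ^^ n) \<phi> differentiable (at x)) \<and>
         compact (closure {x. \<phi> x \<noteq> 0}) \<and> closure {x. \<phi> x \<noteq> 0} \<subseteq> {a<..<b}}"

definition is_weak_deriv :: "real \<Rightarrow> real \<Rightarrow> (real \<Rightarrow> real) \<Rightarrow> (real \<Rightarrow> real) \<Rightarrow> bool" where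
  "is_weak_deriv a b f g \<longleftrightarrow>
     (\<forall>\<phi>\<in>test_functions a b.
        (LINT x|lebesgue_on {a<..<b}. f x * deriv \<phi> x) =
        - (LINT x|lebesgue_on {a<..<b}. g x * \<phi> x))"

definition H1 :: "real \<Rightarrow> real \<Rightarrow> (real \<Rightarrow> real) set" where
  "H1 a b = {f \<in> L2 a b. \<exists>g\<in>L2 a b. is_weak_deriv a b f g}"

definition weak_deriv :: "real \<Rightarrow> real \<Rightarrow> (real \<Rightarrow> real) \<Rightarrow> real \<Rightarrow> real" where
  "weak_deriv a b f = (SOME g. g \<in> L2 a b \<and> is_weak_deriv a b f g)"

definition H1_norm :: "real \<Rightarrow> real \<Rightarrow> (real \<Rightarrow> real) \<Rightarrow> real" where
  "H1_norm a b f = sqrt ((L2_norm a b f)\<^sup>2 + (L2_norm a b (weak_deriv a b f))\<^sup>2)"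

text \<open>Point values of $f \in H^1(a,b)$ on the closed interval $[a,b]$, endpoints included, are those
  of its continuous representative. They are uniquely determined if $a < b$.\<close>

definition cont_rep :: "real \<Rightarrow> real \<Rightarrow> (real \<Rightarrow> real) \<Rightarrow> real \<Rightarrow> real" where
  "cont_rep a b f =
     (SOME h. continuous_on {a..b} h \<and> (AE x in lebesgue_on {a<..<b}. f x = h x))"

text \<open>Functions of $(t,x)$ are curried: \<open>f t\<close> is the space-dependent function at time \<open>t\<close>.
  Time regularity on $[t_0,t_1]$ is with respect to the norm of the space of values, one-sided at
  the endpoints.\<close>

definition C0_L2 :: "real \<Rightarrow> real \<Rightarrow> real \<Rightarrow> real \<Rightarrow> (real \<Rightarrow> real \<Rightarrow> real) set" where
  "C0_L2 t0 t1 a b =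
     {f. \<forall>t\<in>{t0..t1}. f t \<in> L2 a b \<and>
           ((\<lambda>s. L2_norm a b (\<lambda>x. f s x - f t x)) \<longlongrightarrow> 0) (at t within {t0..t1})}"

definition C0_H1 :: "real \<Rightarrow> real \<Rightarrow> real \<Rightarrow> real \<Rightarrow> (real \<Rightarrow> real \<Rightarrow> real) set" where
  "C0_H1 t0 t1 a b =
     {f. \<forall>t\<in>{t0..t1}. f t \<in> H1 a b \<and>
           ((\<lambda>s. H1_norm a b (\<lambda>x. f s x - f t x)) \<longlongrightarrow> 0) (at t within {t0..t1})}"

definition is_time_deriv ::
  "real \<Rightarrow> real \<Rightarrow> real \<Rightarrow> real \<Rightarrow> (real \<Rightarrow> real \<Rightarrow> real) \<Rightarrow> real \<Rightarrow> (real \<Rightarrow> real) \<Rightarrow> bool" where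
  "is_time_deriv t0 t1 a b f t g \<longleftrightarrow>
     ((\<lambda>s. L2_norm a b (\<lambda>x. (f s x - f t x) / (s - t) - g x)) \<longlongrightarrow> 0) (at t within {t0..t1})"

definition time_deriv ::
  "real \<Rightarrow> real \<Rightarrow> real \<Rightarrow> real \<Rightarrow> (real \<Rightarrow> real \<Rightarrow> real) \<Rightarrow> real \<Rightarrow> real \<Rightarrow> real" where
  "time_deriv t0 t1 a b f t = (SOME g. g \<in> L2 a b \<and> is_time_deriv t0 t1 a b f t g)"

definition C1_L2 :: "real \<Rightarrow> real \<Rightarrow> real \<Rightarrow> real \<Rightarrow> (real \<Rightarrow> real \<Rightarrow> real) set" where
  "C1_L2 t0 t1 a b =
     {f. (\<forall>t\<in>{t0..t1}. f t \<in> L2 a b \<and> (\<exists>g\<in>L2 a b. is_time_deriv t0 t1 a b f t g)) \<and>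
         time_deriv t0 t1 a b f \<in> C0_L2 t0 t1 a b}"

end

theory Submission
  imports Defs
begin

text \<open>Write \<open>I\<close> for the interval \<open>{xmin<..<xmax}\<close> and \<open>\<langle>f, g\<rangle>\<close> for the \<open>L\<^sup>2\<close> pairing on \<open>I\<close>, so that
  \<open>T \<psi> t = \<langle>a t, \<psi> t\<rangle>\<close>. The operator \<open>T\<close> intertwines the transport dynamics with the filter
  \<open>z' = lam z + y\<close>: differentiating the pairing and inserting both transport equations gives
  \<open>(T \<psi>)' = lam (T \<psi>) + y - G (\<langle>a\<^sub>x, \<psi>\<rangle> + \<langle>a, \<psi>\<^sub>x\<rangle>)\<close>,
  where the source \<open>x\<^sup>3\<close> of the equation for \<open>a\<close> has produced the output \<open>y\<close>. The last bracket is the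
  boundary term \<open>a \<psi>\<close> between \<open>xmin\<close> and \<open>xmax\<close>, which vanishes because \<open>a\<close> is zero at the left end
  and \<open>\<psi>\<close> at the right end. Hence \<open>T \<psi>\<close> and \<open>z\<close> solve the same scalar equation, and their difference
  is a multiple of \<open>exp (lam t)\<close>.

  Two facts carry the argument. The product rule for the pairing of two \<open>C\<^sup>1\<close> curves in \<open>L\<^sup>2\<close>
  (\<open>L2_inner_has_real_derivative\<close>) rests on the Cauchy-Schwarz inequality alone. Integration by parts
  in \<open>H\<^sup>1\<close> (\<open>H1_integration_by_parts\<close>) takes more work, since weak derivatives are specified only
  through test functions. Fubini's theorem yields the formula for primitives of integrable functions
  (\<open>primitive_by_parts\<close>); in particular such a primitive has the expected weak derivative, so an
  \<open>H\<^sup>1\<close> function differs from the primitive of its weak derivative by a function that annihilates all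
  derivatives of test functions. By the lemma of du Bois-Reymond (\<open>du_Bois_Reymond\<close>) that
  difference is constant almost everywhere. The lemma itself needs a supply of test functions that
  converge boundedly to the indicator of any interval; these are built from \<open>exp (- 1 / x)\<close>.\<close>

section \<open>Smooth functions on the line\<close>

text \<open>Recursion on the first derivative, rather than a condition on the iterates \<open>(deriv ^^ n) f\<close>, makes
  closure under products an induction in which no formula for higher derivatives of a product
  appears.\<close>
primrec times_differentiable :: "nat \<Rightarrow> (real \<Rightarrow> real) \<Rightarrow> bool" where
  "times_differentiable 0 f \<longleftrightarrow> True"
| "times_differentiable (Suc n) f \<longleftrightarrow>
     (\<forall>x. f differentiable at x) \<and> times_differentiable n (deriv f)"

definition smooth :: "(real \<Rightarrow> real) \<Rightarrow> bool" where
  "smooth f \<longleftrightarrow> (\<forall>n. times_differentiable n f)"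

lemma times_differentiable_funpow:
  "times_differentiable (Suc n) f \<Longrightarrow> (deriv ^^ n) f differentiable at x"
proof (induction n arbitrary: f)
  case (Suc n)
  from Suc.IH[of "deriv f"] Suc.prems show ?case
    by (simp add: funpow_Suc_right del: funpow.simps)
qed simp

lemma smooth_funpow_deriv: "smooth f \<Longrightarrow> (deriv ^^ n) f differentiable at x"
  unfolding smooth_def using times_differentiable_funpow by blast

lemma times_differentiable_has_deriv:
  assumes "times_differentiable (Suc n) f"
  shows "(f has_real_derivative deriv f x) (at x)"
  using assms by (simp add: DERIV_deriv_iff_real_differentiable)

lemma times_differentiable_SucI:
  assumes "\<And>x. (f has_real_derivative f' x) (at x)" "times_differentiable n f'"
  shows "times_differentiable (Suc n) f"
proof -
  have "deriv f = f'" using assms(1) by (auto intro: DERIV_imp_deriv)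
  then show ?thesis using assms by (auto simp: real_differentiable_def)
qed

lemma times_differentiable_SucD:
  "times_differentiable (Suc n) f \<Longrightarrow> times_differentiable n f"
  by (induction n arbitrary: f) auto

lemma times_differentiable_const: "times_differentiable n (\<lambda>x. c)"
proof (induction n arbitrary: c)
  case (Suc n)
  show ?case by (rule times_differentiable_SucI[of _ "\<lambda>x. 0"]) (use Suc in auto)
qed simp

lemma times_differentiable_add:
  "times_differentiable n f \<Longrightarrow> times_differentiable n g \<Longrightarrow> times_differentiable n (\<lambda>x. f x + g x)"
proof (induction n arbitrary: f g)
  case (Suc n)
  show ?case
    by (rule times_differentiable_SucI[of _ "\<lambda>x. deriv f x + deriv g x"])
       (use Suc times_differentiable_has_deriv in \<open>auto intro!: DERIV_add\<close>)
qed simp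

lemma times_differentiable_mult:
  "times_differentiable n f \<Longrightarrow> times_differentiable n g \<Longrightarrow> times_differentiable n (\<lambda>x. f x * g x)"
proof (induction n arbitrary: f g)
  case (Suc n)
  show ?case
  proof (rule times_differentiable_SucI)
    show "((\<lambda>x. f x * g x) has_real_derivative deriv f x * g x + deriv g x * f x) (at x)" for x
      using Suc.prems times_differentiable_has_deriv by (blast intro: DERIV_mult)
    show "times_differentiable n (\<lambda>x. deriv f x * g x + deriv g x * f x)"
      using Suc.prems times_differentiable_SucD[of n]
      by (intro times_differentiable_add Suc.IH) auto
  qed
qed simp

lemma times_differentiable_affine:
  "times_differentiable n f \<Longrightarrow> times_differentiable n (\<lambda>x. f (c * x + d))"
proof (induction n arbitrary: f)
  case (Suc n)
  show ?case
  proof (rule times_differentiable_SucI)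
    show "((\<lambda>x. f (c * x + d)) has_real_derivative deriv f (c * x + d) * c) (at x)" for x
      by (rule DERIV_chain2)
         (use Suc.prems times_differentiable_has_deriv in \<open>auto intro!: derivative_eq_intros\<close>)
    show "times_differentiable n (\<lambda>x. deriv f (c * x + d) * c)"
      using Suc by (intro times_differentiable_mult times_differentiable_const) auto
  qed
qed simp

lemma smooth_mult: "smooth f \<Longrightarrow> smooth g \<Longrightarrow> smooth (\<lambda>x. f x * g x)"
  and smooth_add: "smooth f \<Longrightarrow> smooth g \<Longrightarrow> smooth (\<lambda>x. f x + g x)"
  and smooth_const: "smooth (\<lambda>x. c)"
  and smooth_affine: "smooth f \<Longrightarrow> smooth (\<lambda>x. f (c * x + d))"
  by (auto simp: smooth_def intro: times_differentiable_mult times_differentiable_const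
      times_differentiable_affine times_differentiable_add)

lemma smooth_antideriv:
  assumes "\<And>x. (f has_real_derivative f' x) (at x)" "smooth f'"
  shows "smooth f"
  unfolding smooth_def
proof
  fix n show "times_differentiable n f"
    using times_differentiable_SucI[OF assms(1)] assms(2) times_differentiable_SucD
    unfolding smooth_def by blast
qed

lemma smooth_continuous_on: "smooth f \<Longrightarrow> continuous_on S f"
  unfolding smooth_def
  by (meson DERIV_continuous continuous_at_imp_continuous_on times_differentiable_has_deriv)

section \<open>Smooth approximations of indicators of intervals\<close>

text \<open>For \<open>k = 0\<close> this is the standard smooth function that is flat at the origin. The powers of \<open>1 / x\<close> are
  included because they make the family closed under differentiation up to linear combinations.\<close>
definition flat :: "nat \<Rightarrow> real \<Rightarrow> real" where
  "flat k x = (if x > 0 then (1 / x) ^ k * exp (- (1 / x)) else 0)"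

text \<open>The difference quotient of \<open>flat k\<close> at the origin is \<open>flat (Suc k)\<close>, so this limit is what makes the
  two branches fit together differentiably.\<close>
lemma flat_tendsto_0: "(flat k \<longlongrightarrow> 0) (at 0)"
proof -
  have "((\<lambda>x. inverse x ^ k / exp (inverse x)) \<longlongrightarrow> (0::real)) (at_right 0)"
    by (rule filterlim_compose[OF tendsto_power_div_exp_0 filterlim_inverse_at_top_right])
  then have "(flat k \<longlongrightarrow> 0) (at_right 0)"
    by (rule Lim_transform_eventually)
       (auto simp: eventually_at_right_field flat_def exp_minus divide_inverse power_inverse
          intro!: exI[of _ 1])
  moreover have "(flat k \<longlongrightarrow> 0) (at_left 0)"
    by (rule Lim_transform_eventually[of "\<lambda>x. 0"])
       (auto simp: eventually_at_left_field flat_def intro!: exI[of _ "-1"])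
  ultimately show ?thesis by (simp add: filterlim_at_split)
qed

lemma flat_has_derivative:
  "(flat k has_real_derivative flat (Suc (Suc k)) x - real k * flat (Suc k) x) (at x)"
proof (cases "x = 0")
  case True
  have "((\<lambda>h. (flat k (0 + h) - flat k 0) / h) \<longlongrightarrow> 0) (at 0)"
    by (rule Lim_transform_eventually[OF flat_tendsto_0[of "Suc k"]])
       (auto simp: flat_def eventually_at_filter)
  then show ?thesis using True by (simp add: DERIV_def flat_def)
next
  case False
  show ?thesis
  proof (cases "x > 0")
    case True
    have "((\<lambda>x. (1 / x) ^ k * exp (- (1 / x))) has_real_derivative
           flat (Suc (Suc k)) x - real k * flat (Suc k) x) (at x)"
      apply (rule derivative_eq_intros refl | use True in simp; fail)+
      using True
      by (cases k) (auto simp: flat_def field_simps power2_eq_square)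
    then show ?thesis
      by (rule has_field_derivative_transform_within[where d = x])
         (use True in \<open>auto simp: flat_def dist_real_def\<close>)
  next
    case False2: False
    show ?thesis
      by (rule has_field_derivative_transform_within[where d = "-x" and f = "\<lambda>x. 0"])
         (use False False2 in \<open>auto simp: flat_def dist_real_def\<close>)
  qed
qed

text \<open>The derivative formula expresses \<open>deriv (flat k)\<close> through other members of the family, so an
  induction over the number of derivatives, for all \<open>k\<close> at once, suffices.\<close>
lemma smooth_flat: "smooth (flat k)"
  unfolding smooth_def
proof
  fix n show "times_differentiable n (flat k)"
  proof (induction n arbitrary: k)
    case (Suc n)
    have "times_differentiable n (\<lambda>x. flat (Suc (Suc k)) x + (- real k) * flat (Suc k) x)"
      by (intro times_differentiable_add times_differentiable_mult times_differentiable_const Suc)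
    then show ?case
      by (intro times_differentiable_SucI[OF flat_has_derivative]) simp
  qed simp
qed

text \<open>Since \<open>flat 0 (n s)\<close> increases to 1 as \<open>n\<close> grows if \<open>s > 0\<close>, and is 0 if \<open>s \<le> 0\<close>, these smooth
  functions live on \<open>{p<..<q}\<close> and tend pointwise to its indicator.\<close>
definition plateau :: "real \<Rightarrow> real \<Rightarrow> nat \<Rightarrow> real \<Rightarrow> real" where
  "plateau p q n x = flat 0 (real n * (x - p)) * flat 0 (real n * (q - x))"

lemma smooth_plateau: "smooth (plateau p q n)"
proof -
  have "smooth (\<lambda>x. flat 0 (real n * x + - real n * p) * flat 0 (- real n * x + real n * q))"
    by (intro smooth_mult smooth_affine smooth_flat)
  then show ?thesis by (simp add: plateau_def[abs_def] algebra_simps)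
qed

lemma plateau_bounds: "0 \<le> plateau p q n x" "plateau p q n x \<le> 1"
  by (auto simp: plateau_def flat_def mult_le_one)

lemma plateau_eq_0: "x \<notin> {p<..<q} \<Longrightarrow> plateau p q n x = 0"
  by (auto simp: plateau_def flat_def zero_less_mult_iff)

lemma plateau_tendsto: "(\<lambda>n. plateau p q n x) \<longlonglongrightarrow> indicator {p<..<q} x"
proof (cases "x \<in> {p<..<q}")
  case True
  have *: "(\<lambda>n. flat 0 (real n * s)) \<longlonglongrightarrow> 1" if "s > 0" for s
  proof -
    have "(\<lambda>n. exp (- ((1 / s) * inverse (real n)))) \<longlonglongrightarrow> exp (- ((1 / s) * 0))"
      by (intro tendsto_intros lim_inverse_n)
    then have "(\<lambda>n. exp (- ((1 / s) * inverse (real n)))) \<longlonglongrightarrow> 1" by simp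
    then show ?thesis
      by (rule Lim_transform_eventually)
         (use that in \<open>auto intro!: eventually_mono[OF eventually_gt_at_top[of 0]] simp: flat_def field_simps\<close>)
  qed
  have "(\<lambda>n. flat 0 (real n * (x - p)) * flat 0 (real n * (q - x))) \<longlonglongrightarrow> 1 * 1"
    by (intro tendsto_mult *) (use True in auto)
  then show ?thesis using True by (simp add: plateau_def)
next
  case False
  then show ?thesis by (simp add: plateau_eq_0)
qed

section \<open>Primitives of integrable functions\<close>

lemma finite_measure_interval: "finite_measure (lebesgue_on {a<..<b::real})"
  by (intro finite_measure_lebesgue_on) auto

lemma AE_lebesgue_on_neq: "AE y in lebesgue_on S. y \<noteq> (x::real)" if "S \<in> sets lebesgue"
proof -
  have "AE y in lebesgue. y \<noteq> x"
    by (rule AE_completion) (rule AE_lborel_singleton)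
  then show ?thesis
    using that by (subst AE_restrict_space_iff) auto
qed

lemma ident_measurable_lebesgue_on: "(\<lambda>x::real. x) \<in> borel_measurable (lebesgue_on S)"
  by (intro measurable_restrict_space1 measurable_completion) auto

text \<open>This is the integral of \<open>g\<close> from \<open>a\<close> to \<open>x\<close>. The region of integration enters through an indicator so
  that all primitives are integrals over one fixed finite measure, as Fubini's theorem wants.\<close>
definition primitive :: "real \<Rightarrow> real \<Rightarrow> (real \<Rightarrow> real) \<Rightarrow> real \<Rightarrow> real" where
  "primitive a b g x = (LINT y|lebesgue_on {a<..<b}. indicator {..<x} y * g y)"

lemma integrable_indicator_mult:
  fixes g :: "real \<Rightarrow> real"
  assumes "integrable (lebesgue_on S) g" "A \<in> sets borel"
  shows "integrable (lebesgue_on S) (\<lambda>y. indicator A y * g y)"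
proof (rule Bochner_Integration.integrable_bound[OF assms(1)])
  have [measurable]: "(\<lambda>y. indicator A y :: real) \<in> borel_measurable (lebesgue_on S)"
    by (rule measurable_compose[OF ident_measurable_lebesgue_on borel_measurable_indicator[OF assms(2)]])
  show "(\<lambda>y. indicator A y * g y) \<in> borel_measurable (lebesgue_on S)"
    using borel_measurable_integrable[OF assms(1)] by measurable
qed (auto simp: indicator_def)

lemma primitive_left: "primitive a b g a = 0"
  unfolding primitive_def
  by (rule integral_eq_zero_AE) (auto simp: indicator_def intro!: AE_I2)

lemma primitive_right: "primitive a b g b = integral\<^sup>L (lebesgue_on {a<..<b}) g"
  unfolding primitive_def by (rule Bochner_Integration.integral_cong) (auto simp: indicator_def)

lemma primitive_continuous:
  assumes g: "integrable (lebesgue_on {a<..<b}) g"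
  shows "continuous_on S (primitive a b g)"
proof (rule continuous_on_subset[of UNIV])
  show "continuous_on UNIV (primitive a b g)"
    unfolding continuous_on_sequentially comp_def
  proof clarify
    fix X :: "nat \<Rightarrow> real" and x assume X: "X \<longlonglongrightarrow> x"
    show "(\<lambda>n. primitive a b g (X n)) \<longlonglongrightarrow> primitive a b g x"
      unfolding primitive_def
    proof (rule integral_dominated_convergence[where w = "\<lambda>y. \<bar>g y\<bar>"])
      have "(\<lambda>n. indicator {..<X n} y * g y) \<longlonglongrightarrow> indicator {..<x} y * g y" if "y \<noteq> x" for y
      proof (cases "y < x")
        case True
        then have "\<forall>\<^sub>F n in sequentially. y < X n" using X by (simp add: order_tendsto_iff)
        then show ?thesis using True by (auto elim!: eventually_mono intro!: tendsto_eventually)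
      next
        case False
        then have "\<forall>\<^sub>F n in sequentially. X n < y" using X that by (simp add: order_tendsto_iff)
        then show ?thesis using False by (auto elim!: eventually_mono intro!: tendsto_eventually)
      qed
      then show "AE y in lebesgue_on {a<..<b}.
          (\<lambda>n. indicator {..<X n} y * g y) \<longlonglongrightarrow> indicator {..<x} y * g y"
        using AE_lebesgue_on_neq[of "{a<..<b}" x] by auto
    next
      show "(\<lambda>y. indicator {..<X n} y * g y) \<in> borel_measurable (lebesgue_on {a<..<b})" for n
        using integrable_indicator_mult[OF g] by (intro borel_measurable_integrable) simp
      show "(\<lambda>y. indicator {..<x} y * g y) \<in> borel_measurable (lebesgue_on {a<..<b})"
        using integrable_indicator_mult[OF g] by (intro borel_measurable_integrable) simp
    qed (use g in \<open>auto simp: indicator_def\<close>)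
  qed
qed simp

lemma continuous_borel_measurable_lebesgue_on:
  fixes f :: "real \<Rightarrow> real"
  assumes "continuous_on {a..b} f"
  shows "f \<in> borel_measurable (lebesgue_on {a<..<b})"
  by (rule continuous_imp_measurable_on_sets_lebesgue)
     (use assms in \<open>auto intro: continuous_on_subset\<close>)

lemma integrable_continuous_mult:
  fixes f g :: "real \<Rightarrow> real"
  assumes f: "continuous_on {a..b} f" and g: "integrable (lebesgue_on {a<..<b}) g"
  shows "integrable (lebesgue_on {a<..<b}) (\<lambda>x. f x * g x)"
proof -
  obtain C where C: "\<And>x. x \<in> {a..b} \<Longrightarrow> norm (f x) \<le> C"
    using compact_imp_bounded[OF compact_continuous_image[OF f compact_Icc]]
    unfolding bounded_iff by blast
  have [measurable]: "f \<in> borel_measurable (lebesgue_on {a<..<b})"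
    "g \<in> borel_measurable (lebesgue_on {a<..<b})"
    using continuous_borel_measurable_lebesgue_on[OF f] g by auto
  show ?thesis
  proof (rule Bochner_Integration.integrable_bound)
    show "integrable (lebesgue_on {a<..<b}) (\<lambda>x. C * norm (g x))" using g by auto
    show "AE x in lebesgue_on {a<..<b}. norm (f x * g x) \<le> norm (C * norm (g x))"
    proof (rule AE_I2)
      fix x assume "x \<in> space (lebesgue_on {a<..<b})"
      then have "norm (f x) \<le> \<bar>C\<bar>" using C[of x] by auto
      then show "norm (f x * g x) \<le> norm (C * norm (g x))"
        by (simp add: abs_mult mult_right_mono)
    qed
  qed measurable
qed

lemma continuous_integrable_lebesgue_on:
  fixes f :: "real \<Rightarrow> real"
  assumes "continuous_on {a..b} f"
  shows "integrable (lebesgue_on {a<..<b}) f"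
proof -
  interpret finite_measure "lebesgue_on {a<..<b}" by (rule finite_measure_interval)
  show ?thesis using integrable_continuous_mult[OF assms, where g = "\<lambda>_. 1"] by simp
qed

text \<open>Both integrals on the left are double integrals of \<open>g y * k x\<close>, one over the part of the square below
  the diagonal and one over the part above it. The diagonal is a null set, so together they give the
  integral over the whole square, which factorises.\<close>
lemma primitive_by_parts:
  assumes g: "integrable (lebesgue_on {a<..<b}) g" and k: "integrable (lebesgue_on {a<..<b}) k"
  shows "(LINT x|lebesgue_on {a<..<b}. primitive a b g x * k x) +
         (LINT x|lebesgue_on {a<..<b}. g x * primitive a b k x) =
         integral\<^sup>L (lebesgue_on {a<..<b}) g * integral\<^sup>L (lebesgue_on {a<..<b}) k"
proof -
  define M where "M = lebesgue_on {a<..<b}"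
  interpret M: finite_measure M unfolding M_def by (rule finite_measure_interval)
  interpret P: pair_sigma_finite M M ..
  have g: "integrable M g" and k: "integrable M k" using g k by (simp_all add: M_def)
  note [measurable] = borel_measurable_integrable[OF g] borel_measurable_integrable[OF k]
  have [measurable]: "(\<lambda>x. x) \<in> borel_measurable M"
    unfolding M_def by (rule ident_measurable_lebesgue_on)
  have gk: "integrable (M \<Otimes>\<^sub>M M) (\<lambda>(x, y). k x * g y)"
    by (rule P.Fubini_integrable) (use g k in \<open>auto simp: abs_mult\<close>)
  have lt: "integrable (M \<Otimes>\<^sub>M M) (\<lambda>(x, y). if y < x then k x * g y else 0)"
    by (rule Bochner_Integration.integrable_bound[OF gk]) (measurable, auto)
  have gt: "integrable (M \<Otimes>\<^sub>M M) (\<lambda>(x, y). if x < y then k x * g y else 0)"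
    by (rule Bochner_Integration.integrable_bound[OF gk]) (measurable, auto)
  have "(\<integral>x. primitive a b g x * k x \<partial>M) = (\<integral>x. \<integral>y. (if y < x then k x * g y else 0) \<partial>M \<partial>M)"
    unfolding primitive_def M_def[symmetric] integral_mult_left_zero[symmetric]
    by (intro Bochner_Integration.integral_cong refl) (auto simp: indicator_def)
  moreover have "(\<integral>x. g x * primitive a b k x \<partial>M) =
                 (\<integral>y. \<integral>x. (if x < y then k x * g y else 0) \<partial>M \<partial>M)"
    unfolding primitive_def M_def[symmetric] integral_mult_right_zero[symmetric]
    by (intro Bochner_Integration.integral_cong refl) (auto simp: indicator_def)
  moreover have "\<dots> = (\<integral>x. \<integral>y. (if x < y then k x * g y else 0) \<partial>M \<partial>M)"
    using P.Fubini_integral[OF gt] by simp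
  moreover have "(\<integral>x. \<integral>y. (if y < x then k x * g y else 0) \<partial>M \<partial>M) +
      (\<integral>x. \<integral>y. (if x < y then k x * g y else 0) \<partial>M \<partial>M) = (\<integral>x. k x * (\<integral>y. g y \<partial>M) \<partial>M)"
  proof -
    have "(\<integral>y. (if y < x then k x * g y else 0) \<partial>M) + (\<integral>y. (if x < y then k x * g y else 0) \<partial>M) =
          k x * (\<integral>y. g y \<partial>M)" for x
    proof -
      have 1: "integrable M (\<lambda>y. if y < x then k x * g y else 0)"
        by (rule Bochner_Integration.integrable_bound[of M "\<lambda>y. k x * g y"]) (use g in auto)
      have 2: "integrable M (\<lambda>y. if x < y then k x * g y else 0)"
        by (rule Bochner_Integration.integrable_bound[of M "\<lambda>y. k x * g y"]) (use g in auto)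
      have "(\<integral>y. (if y < x then k x * g y else 0) + (if x < y then k x * g y else 0) \<partial>M) =
            (\<integral>y. k x * g y \<partial>M)"
      proof (rule integral_cong_AE)
        have "AE y in M. y \<noteq> x" unfolding M_def by (rule AE_lebesgue_on_neq) simp
        then show "AE y in M. (if y < x then k x * g y else 0) + (if x < y then k x * g y else 0)
            = k x * g y"
          by eventually_elim auto
      qed measurable
      then show ?thesis using 1 2 by simp
    qed
    then show ?thesis
      using P.integrable_fst'[OF lt] P.integrable_fst'[OF gt]
      by (simp add: Bochner_Integration.integral_add[symmetric])
  qed
  ultimately show ?thesis unfolding M_def[symmetric] by (simp add: mult.commute)
qed

text \<open>The set where two continuous functions differ is open in the interval, so it has positive measure
  unless it is empty; the end points follow by continuity. This is what makes point values of a
  continuous representative well defined.\<close>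
lemma continuous_AE_eq:
  fixes h k :: "real \<Rightarrow> real"
  assumes "a < b" "continuous_on {a..b} h" "continuous_on {a..b} k"
    and "AE x in lebesgue_on {a<..<b}. h x = k x" and x: "x \<in> {a..b}"
  shows "h x = k x"
proof -
  let ?d = "\<lambda>x. h x - k x"
  have d: "continuous_on {a..b} ?d" using assms by (intro continuous_intros)
  define C where "C = {x \<in> {a..b}. ?d x = 0}"
  have closed: "closed C" unfolding C_def by (rule continuous_closed_preimage_constant[OF d]) simp
  have AE: "AE x\<in>{a<..<b} in lebesgue. x \<in> C"
    using assms(4) by (subst (asm) AE_restrict_space_iff) (auto simp: C_def)
  have "{a<..<b} \<subseteq> C"
    using mem_closed_if_AE_lebesgue_open[OF open_greaterThanLessThan closed AE] by blast
  then have "closure {a<..<b} \<subseteq> C" using closed by (rule closure_minimal)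
  then show ?thesis using x \<open>a < b\<close> by (auto simp: C_def)
qed

text \<open>At almost every point \<open>f\<close> is the limit of its averages over shrinking intervals starting there, and
  all these averages vanish.\<close>
lemma AE_zero_if_interval_integrals_zero:
  fixes f :: "real \<Rightarrow> real"
  assumes f: "integrable (lebesgue_on {a<..<b}) f"
    and zero: "\<And>p q. a < p \<Longrightarrow> p < q \<Longrightarrow> q < b \<Longrightarrow>
                 (LINT x|lebesgue_on {a<..<b}. indicator {p<..<q} x * f x) = 0"
  shows "AE x in lebesgue_on {a<..<b}. f x = 0"
proof -
  define F where "F x = (if x \<in> {a<..<b} then f x else 0)" for x
  have F: "integrable lebesgue F"
    unfolding F_def using f by (subst Lebesgue_Measure.integrable_restrict_UNIV) auto
  have Fint: "integrable (lebesgue_on S) F" if "S \<in> sets lebesgue" for S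
    using integrable_mult_indicator[OF that F] that by (subst integrable_restrict_space) auto
  have Fon: "F integrable_on S" if "S \<in> sets lebesgue" for S
    by (rule integrable_on_lebesgue_on[OF Fint]) (fact that)+
  have "F integrable_on cbox p q" for p q by (rule Fon) simp
  from integrable_ccontinuous_explicit[of F, OF this] obtain N where N: "negligible N"
    and leb: "\<And>x e. \<lbrakk>x \<notin> N; 0 < e\<rbrakk> \<Longrightarrow> \<exists>d>0. \<forall>h. 0 < h \<and> h < d \<longrightarrow>
              norm (integral (cbox x (x + h *\<^sub>R One)) F /\<^sub>R h ^ DIM(real) - F x) < e"
    by blast
  have "f x = 0" if x: "x \<in> {a<..<b}" "x \<notin> N" for x
  proof -
    have "\<bar>f x\<bar> < e" if "e > 0" for e
    proof -
      obtain d where "d > 0"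
        and d: "\<And>h. 0 < h \<Longrightarrow> h < d \<Longrightarrow> \<bar>integral {x..x+h} F / h - F x\<bar> < e"
        using leb[OF x(2) \<open>e > 0\<close>] by (auto simp: divide_inverse_commute)
      \<comment> \<open>short enough for the averaging estimate and for staying inside \<open>{a<..<b}\<close>\<close>
      define h where "h = min (d/2) ((b - x)/2)"
      have h: "0 < h" "h < d" "x + h < b" using x \<open>d > 0\<close> by (auto simp: h_def min_def field_simps)
      have "integral {x..x+h} F = integral {x<..<x+h} F"
        by (simp add: integral_open_interval_real)
      also have "\<dots> = integral\<^sup>L (lebesgue_on {x<..<x+h}) F"
        by (rule lebesgue_integral_eq_integral[OF Fint, symmetric]) auto
      also have "\<dots> = (LINT y|lebesgue_on {a<..<b}. indicator {x<..<x+h} y * f y)"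
        unfolding F_def using x h
        by (auto simp: integral_restrict_space indicator_def intro!: Bochner_Integration.integral_cong)
      also have "\<dots> = 0" using zero x h by auto
      finally show ?thesis using d[of h] h x by (simp add: F_def)
    qed
    from this[of "\<bar>f x\<bar>"] show "f x = 0" by auto
  qed
  then have "AE x in lebesgue. x \<in> {a<..<b} \<longrightarrow> f x = 0"
    using N by (intro AE_I'[of N]) (auto simp: negligible_iff_null_sets)
  then show ?thesis by (subst AE_restrict_space_iff) auto
qed

section \<open>The lemma of du Bois-Reymond\<close>

lemma primitive_FTC:
  assumes "\<And>x. (f has_real_derivative f' x) (at x)" and cont: "continuous_on UNIV f'"
    and x: "x \<in> {a..b}"
  shows "primitive a b f' x = f x - f a"
proof -
  have int: "(f' has_integral f x - f a) {a..x}"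
    using assms(1) x
    by (intro fundamental_theorem_of_calculus)
       (auto simp: has_real_derivative_iff_has_vector_derivative[symmetric]
             intro: has_field_derivative_at_within)
  have "primitive a b f' x = integral\<^sup>L (lebesgue_on {a<..<x}) f'"
    unfolding primitive_def using x
    by (auto simp: integral_restrict_space indicator_def intro!: Bochner_Integration.integral_cong)
  also have "\<dots> = integral {a<..<x} f'"
    using continuous_integrable_lebesgue_on[OF continuous_on_subset[OF cont]]
    by (intro lebesgue_integral_eq_integral) auto
  also have "\<dots> = integral {a..x} f'" by (simp add: integral_open_interval_real)
  also have "\<dots> = f x - f a" using int by (rule integral_unique)
  finally show ?thesis .
qed

lemma test_functionD:
  assumes "\<phi> \<in> test_functions a b"
  shows "(\<phi> has_real_derivative deriv \<phi> x) (at x)" "continuous_on S (deriv \<phi>)"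
    "x \<notin> {a<..<b} \<Longrightarrow> \<phi> x = 0"
proof -
  have sm: "(deriv ^^ n) \<phi> differentiable at x" for n x
    using assms by (auto simp: test_functions_def)
  have supp: "closure {x. \<phi> x \<noteq> 0} \<subseteq> {a<..<b}"
    using assms by (auto simp: test_functions_def)
  show "(\<phi> has_real_derivative deriv \<phi> x) (at x)"
    using sm[of 0 x] by (simp add: DERIV_deriv_iff_real_differentiable)
  show "continuous_on S (deriv \<phi>)"
    using sm[of 1] by (intro continuous_at_imp_continuous_on ballI differentiable_imp_continuous_within) simp
  show "x \<notin> {a<..<b} \<Longrightarrow> \<phi> x = 0"
    using supp closure_subset[of "{x. \<phi> x \<noteq> 0}"] by auto
qed

text \<open>The vanishing integral is exactly what lets the antiderivative that starts at 0 return to 0 to the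
  right of the support of \<open>v\<close>, and hence have compact support itself.\<close>
lemma test_function_antiderivative:
  assumes v: "smooth v" and supp: "\<And>x. x \<notin> {l..r} \<Longrightarrow> v x = 0"
    and lr: "a < l" "l \<le> r" "r < b"
    and zero: "integral\<^sup>L (lebesgue_on {a<..<b}) v = 0"
  obtains \<phi> where "\<phi> \<in> test_functions a b" "deriv \<phi> = v"
proof
  define \<phi> where "\<phi> x = integral {a..x} v" for x
  have cont: "continuous_on S v" for S using v by (rule smooth_continuous_on)
  have \<phi>_eq: "\<phi> x = integral {l..min x r} v" for x
  proof -
    have "\<phi> x = integral {a..x} (\<lambda>x. if x \<in> {l..r} then v x else 0)"
      unfolding \<phi>_def using supp by (intro Henstock_Kurzweil_Integration.integral_cong) auto
    also have "\<dots> = integral ({l..r} \<inter> {a..x}) v"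
      by (rule Henstock_Kurzweil_Integration.integral_restrict_Int)
    also have "{l..r} \<inter> {a..x} = {l..min x r}" using lr by auto
    finally show ?thesis .
  qed
  have left: "\<phi> x = 0" if "x < l" for x using that by (simp add: \<phi>_eq)
  have deriv: "(\<phi> has_real_derivative v x) (at x)" for x
  proof (cases "a < x")
    case True
    have "(\<phi> has_real_derivative v x) (at x within {a..x+1})"
      unfolding \<phi>_def using True by (intro integral_has_real_derivative cont) auto
    then show ?thesis using True by (simp add: at_within_Icc_at)
  next
    case False
    then have "v x = 0" using supp lr by auto
    moreover have "((\<lambda>x. 0) has_real_derivative 0) (at x)" by simp
    then have "(\<phi> has_real_derivative 0) (at x)"
      by (rule has_field_derivative_transform_within_open[where S = "{..<l}"])
         (use left False lr in auto)
    ultimately show ?thesis by simp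
  qed
  have "\<phi> b = primitive a b v b"
    using primitive_FTC[OF deriv cont, of b a b] lr left[of a] by simp
  then have "\<phi> b = 0" by (simp add: primitive_right zero)
  then have right: "\<phi> x = 0" if "r < x" for x
    using that lr by (simp add: \<phi>_eq min_def split: if_splits)
  have supp\<phi>: "closure {x. \<phi> x \<noteq> 0} \<subseteq> {l..r}"
    using left right by (intro closure_minimal) (auto simp: not_less[symmetric])
  then have "compact (closure {x. \<phi> x \<noteq> 0})"
    by (auto simp: compact_eq_bounded_closed intro: bounded_subset[OF bounded_closed_interval])
  moreover have "closure {x. \<phi> x \<noteq> 0} \<subseteq> {a<..<b}" using supp\<phi> lr by fastforce
  moreover have "smooth \<phi>" using smooth_antideriv[OF deriv v] .
  ultimately show "\<phi> \<in> test_functions a b"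
    by (auto simp: test_functions_def smooth_funpow_deriv)
  show "deriv \<phi> = v" using deriv by (auto intro: DERIV_imp_deriv)
qed

lemma integral_plateau_tendsto:
  assumes h: "integrable (lebesgue_on {a<..<b}) h"
  shows "(\<lambda>n. LINT x|lebesgue_on {a<..<b}. h x * plateau p q n x) \<longlonglongrightarrow>
         (LINT x|lebesgue_on {a<..<b}. h x * indicator {p<..<q} x)"
proof (rule integral_dominated_convergence[where w = "\<lambda>x. \<bar>h x\<bar>"])
  show "(\<lambda>x. h x * indicator {p<..<q} x) \<in> borel_measurable (lebesgue_on {a<..<b})"
    using integrable_indicator_mult[OF h, of "{p<..<q}"]
    by (intro borel_measurable_integrable) (simp add: mult.commute)
  show "(\<lambda>x. h x * plateau p q n x) \<in> borel_measurable (lebesgue_on {a<..<b})" for n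
    using integrable_continuous_mult[OF smooth_continuous_on[OF smooth_plateau] h, of p q n]
    by (intro borel_measurable_integrable) (simp add: mult.commute)
  show "AE x in lebesgue_on {a<..<b}. norm (h x * plateau p q n x) \<le> \<bar>h x\<bar>" for n
    by (rule AE_I2) (use plateau_bounds[of p q n] in \<open>auto simp: abs_mult intro!: mult_left_le\<close>)
qed (use h in \<open>auto intro!: AE_I2 tendsto_mult plateau_tendsto\<close>)

lemma measure_lebesgue_on_interval:
  fixes a b p q :: real
  assumes "a \<le> p" "p \<le> q" "q \<le> b"
  shows "measure (lebesgue_on {a<..<b}) {p<..<q} = q - p"
  using assms by (subst measure_restrict_space) auto

text \<open>For two intervals, the plateau functions \<open>w\<close> and \<open>w\<^sub>0\<close>, with integrals \<open>W\<close> and \<open>W\<^sub>0\<close>, combine to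
  \<open>W\<^sub>0 w - W w\<^sub>0\<close>, which has integral 0 and so is the derivative of a test function. Orthogonality
  of \<open>h\<close> to it passes to the limit of indicators: the integral of \<open>h\<close> over an interval is proportional
  to the length of the interval. With \<open>c\<close> the factor of proportionality, \<open>h - c\<close> has vanishing
  integral over every interval.\<close>
lemma du_Bois_Reymond:
  assumes "a < b" and h: "integrable (lebesgue_on {a<..<b}) h"
    and orth: "\<And>\<phi>. \<phi> \<in> test_functions a b \<Longrightarrow> (LINT x|lebesgue_on {a<..<b}. h x * deriv \<phi> x) = 0"
  obtains c where "AE x in lebesgue_on {a<..<b}. h x = c"
proof -
  interpret finite_measure "lebesgue_on {a<..<b}" by (rule finite_measure_interval)
  define I where "I p q = (LINT x|lebesgue_on {a<..<b}. h x * indicator {p<..<q} x)" for p q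
  obtain p0 where p0: "a < p0" "p0 < b" using dense[OF \<open>a < b\<close>] by blast
  obtain q0 where q0: "p0 < q0" "q0 < b" using dense[OF p0(2)] by blast
  have proportional: "(q0 - p0) * I p q = (q - p) * I p0 q0" if pq: "a < p" "p < q" "q < b" for p q
  proof (rule LIMSEQ_unique)
    let ?w = "\<lambda>p q n. integral\<^sup>L (lebesgue_on {a<..<b}) (plateau p q n)"
    let ?hw = "\<lambda>p q n. LINT x|lebesgue_on {a<..<b}. h x * plateau p q n x"
    have w: "?w p q \<longlonglongrightarrow> q - p" if "a \<le> p" "p \<le> q" "q \<le> b" for p q
      using integral_plateau_tendsto[of a b "\<lambda>_. 1" p q] that
      by (simp add: measure_lebesgue_on_interval)
    have hw: "?hw p q \<longlonglongrightarrow> I p q" for p q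
      unfolding I_def by (rule integral_plateau_tendsto[OF h])
    show "(\<lambda>n. ?w p0 q0 n * ?hw p q n) \<longlonglongrightarrow> (q0 - p0) * I p q"
      using p0 q0 by (intro tendsto_mult w hw) auto
    have "(\<lambda>n. ?w p q n * ?hw p0 q0 n) \<longlonglongrightarrow> (q - p) * I p0 q0"
      using pq by (intro tendsto_mult w hw) auto
    moreover have "?w p q n * ?hw p0 q0 n = ?w p0 q0 n * ?hw p q n" for n
    proof -
      \<comment> \<open>integral 0, hence the derivative of a test function\<close>
      define v where "v x = ?w p0 q0 n * plateau p q n x + (- ?w p q n) * plateau p0 q0 n x" for x
      have int: "integrable (lebesgue_on {a<..<b}) (plateau p q n)"
           "integrable (lebesgue_on {a<..<b}) (\<lambda>x. h x * plateau p q n x)" for p q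
        using continuous_integrable_lebesgue_on[OF smooth_continuous_on[OF smooth_plateau], of a b p q n]
          integrable_continuous_mult[OF smooth_continuous_on[OF smooth_plateau] h, of p q n]
        by (simp_all add: mult.commute)
      have smooth: "smooth v" unfolding v_def
        by (intro smooth_add smooth_mult smooth_const smooth_plateau)
      have supp: "v x = 0" if "x \<notin> {min p p0..max q q0}" for x
      proof -
        have "x \<notin> {p<..<q}" "x \<notin> {p0<..<q0}" using that by auto
        from this[THEN plateau_eq_0] show ?thesis by (simp add: v_def)
      qed
      have zero: "integral\<^sup>L (lebesgue_on {a<..<b}) v = 0"
        unfolding v_def using int by simp
      obtain \<phi> where "\<phi> \<in> test_functions a b" "deriv \<phi> = v"
        by (rule test_function_antiderivative[where l = "min p p0" and r = "max q q0",
              OF smooth supp _ _ _ zero]) (use p0 q0 pq in auto)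
      then have "(LINT x|lebesgue_on {a<..<b}. h x * v x) = 0" using orth by blast
      moreover have "(LINT x|lebesgue_on {a<..<b}. h x * v x) =
          (LINT x|lebesgue_on {a<..<b}. ?w p0 q0 n * (h x * plateau p q n x) -
              ?w p q n * (h x * plateau p0 q0 n x))"
        by (intro Bochner_Integration.integral_cong) (auto simp: v_def algebra_simps)
      ultimately show ?thesis using int by simp
    qed
    ultimately show "(\<lambda>n. ?w p0 q0 n * ?hw p q n) \<longlonglongrightarrow> (q - p) * I p0 q0" by simp
  qed
  define c where "c = I p0 q0 / (q0 - p0)"
  have "AE x in lebesgue_on {a<..<b}. h x - c = 0"
  proof (rule AE_zero_if_interval_integrals_zero)
    show "integrable (lebesgue_on {a<..<b}) (\<lambda>x. h x - c)" using h by simp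
    fix p q assume pq: "a < p" "p < q" "q < b"
    have "(LINT x|lebesgue_on {a<..<b}. indicator {p<..<q} x * (h x - c)) =
          (LINT x|lebesgue_on {a<..<b}. h x * indicator {p<..<q} x - c * indicator {p<..<q} x)"
      by (intro Bochner_Integration.integral_cong) (auto simp: algebra_simps)
    also have "\<dots> = I p q - c * (q - p)"
      unfolding I_def
      using integrable_indicator_mult[OF h, of "{p<..<q}"] pq
        integrable_indicator_mult[of "{a<..<b}" "\<lambda>_. 1" "{p<..<q}"]
      by (subst Bochner_Integration.integral_diff) (auto simp: measure_lebesgue_on_interval mult.commute)
    also have "\<dots> = 0" using proportional[OF pq] q0 by (simp add: c_def field_simps)
    finally show "(LINT x|lebesgue_on {a<..<b}. indicator {p<..<q} x * (h x - c)) = 0" .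
  qed
  then show ?thesis using that[of c] by simp
qed

section \<open>Integration by parts in $H^1$\<close>

text \<open>On a set of finite measure, \<open>1 + f\<^sup>2\<close> is an integrable bound of \<open>\<bar>f\<bar>\<close>.\<close>
lemma L2_integrable:
  assumes "f \<in> L2 a b"
  shows "integrable (lebesgue_on {a<..<b}) f"
proof -
  interpret finite_measure "lebesgue_on {a<..<b}" by (rule finite_measure_interval)
  have sq: "integrable (lebesgue_on {a<..<b}) (\<lambda>x. (f x)\<^sup>2)"
    and m: "f \<in> borel_measurable (lebesgue_on {a<..<b})"
    using assms by (auto simp: L2_def)
  have "\<bar>s\<bar> \<le> 1 + s\<^sup>2" for s :: real
    using zero_le_power2[of "\<bar>s\<bar> - 1"] by (simp add: power2_diff)
  then show ?thesis
    by (intro Bochner_Integration.integrable_bound[OF _ m, of "\<lambda>x. 1 + (f x)\<^sup>2"])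
       (use sq in \<open>auto intro!: AE_I2\<close>)
qed

text \<open>A test function is the primitive of its derivative, whose total integral is 0. Integration by parts
  for primitives therefore shows that \<open>primitive a b g\<close> has the weak derivative \<open>g\<close>, as \<open>f\<close> has, and
  \<open>f - primitive a b g\<close> is orthogonal to derivatives of test functions.\<close>
lemma weak_deriv_imp_AE_primitive:
  assumes "a < b" and f: "integrable (lebesgue_on {a<..<b}) f"
    and g: "integrable (lebesgue_on {a<..<b}) g" and fg: "is_weak_deriv a b f g"
  obtains c where "AE x in lebesgue_on {a<..<b}. f x = c + primitive a b g x"
proof -
  interpret finite_measure "lebesgue_on {a<..<b}" by (rule finite_measure_interval)
  have P: "integrable (lebesgue_on {a<..<b}) (primitive a b g)"
    by (intro continuous_integrable_lebesgue_on primitive_continuous g)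
  have "(LINT x|lebesgue_on {a<..<b}. (f x - primitive a b g x) * deriv \<phi> x) = 0"
    if \<phi>: "\<phi> \<in> test_functions a b" for \<phi>
  proof -
    note D = test_functionD[OF \<phi>]
    have int: "integrable (lebesgue_on {a<..<b}) (deriv \<phi>)"
      by (intro continuous_integrable_lebesgue_on D(2))
    have prim: "primitive a b (deriv \<phi>) x = \<phi> x" if "x \<in> {a..b}" for x
      using primitive_FTC[OF D(1,2) that] D(3)[of a] by simp
    have "integral\<^sup>L (lebesgue_on {a<..<b}) (deriv \<phi>) = 0"
      using prim[of b] D(3)[of b] \<open>a < b\<close> by (simp add: primitive_right)
    then have "(LINT x|lebesgue_on {a<..<b}. primitive a b g x * deriv \<phi> x) =
        - (LINT x|lebesgue_on {a<..<b}. g x * primitive a b (deriv \<phi>) x)"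
      using primitive_by_parts[OF g int] by simp
    also have "\<dots> = - (LINT x|lebesgue_on {a<..<b}. g x * \<phi> x)"
      using prim by (auto intro!: Bochner_Integration.integral_cong)
    also have "\<dots> = (LINT x|lebesgue_on {a<..<b}. f x * deriv \<phi> x)"
      using fg \<phi> by (simp add: is_weak_deriv_def)
    finally show ?thesis
      using integrable_continuous_mult[OF D(2) f] integrable_continuous_mult[OF D(2) P]
      by (simp add: algebra_simps)
  qed
  then obtain c where "AE x in lebesgue_on {a<..<b}. f x - primitive a b g x = c"
    using du_Bois_Reymond[OF \<open>a < b\<close>, of "\<lambda>x. f x - primitive a b g x"] f P by auto
  then show ?thesis by (intro that[of c]) auto
qed

text \<open>The function \<open>c + primitive a b g\<close> is continuous, which shows both that a continuous representative
  exists and, by uniqueness, that it is the one chosen by \<open>cont_rep\<close>.\<close>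
lemma H1_representation:
  assumes "a < b" and f: "f \<in> L2 a b" and g: "g \<in> L2 a b" and fg: "is_weak_deriv a b f g"
  obtains c where "AE x in lebesgue_on {a<..<b}. f x = c + primitive a b g x"
    "\<And>x. x \<in> {a..b} \<Longrightarrow> cont_rep a b f x = c + primitive a b g x"
proof -
  note f = L2_integrable[OF f] and g = L2_integrable[OF g]
  obtain c where c: "AE x in lebesgue_on {a<..<b}. f x = c + primitive a b g x"
    using weak_deriv_imp_AE_primitive[OF \<open>a < b\<close> f g fg] .
  have cont: "continuous_on {a..b} (\<lambda>x. c + primitive a b g x)"
    by (intro continuous_intros primitive_continuous g)
  have "continuous_on {a..b} (cont_rep a b f) \<and>
        (AE x in lebesgue_on {a<..<b}. f x = cont_rep a b f x)"
    unfolding cont_rep_def by (rule someI[of _ "\<lambda>x. c + primitive a b g x"]) (use cont c in auto)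
  then have "cont_rep a b f x = c + primitive a b g x" if "x \<in> {a..b}" for x
    by (intro continuous_AE_eq[OF \<open>a < b\<close> _ cont _ that]) (use c in auto)
  then show ?thesis using that c by blast
qed

text \<open>After replacing \<open>f\<close> and \<open>g\<close> by constants plus primitives, the formula for primitives supplies the
  product of the total integrals of \<open>f'\<close> and \<open>g'\<close>; the integrals of \<open>g'\<close> and \<open>f'\<close> against the two
  constants complete it to the difference of boundary values.\<close>
theorem H1_integration_by_parts:
  assumes "a < b"
    and f: "f \<in> L2 a b" "f' \<in> L2 a b" "is_weak_deriv a b f f'"
    and g: "g \<in> L2 a b" "g' \<in> L2 a b" "is_weak_deriv a b g g'"
  shows "(LINT x|lebesgue_on {a<..<b}. f x * g' x) + (LINT x|lebesgue_on {a<..<b}. f' x * g x) =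
         cont_rep a b f b * cont_rep a b g b - cont_rep a b f a * cont_rep a b g a"
proof -
  obtain c where c: "AE x in lebesgue_on {a<..<b}. f x = c + primitive a b f' x"
    "\<And>x. x \<in> {a..b} \<Longrightarrow> cont_rep a b f x = c + primitive a b f' x"
    using H1_representation[OF \<open>a < b\<close> f] by blast
  obtain d where d: "AE x in lebesgue_on {a<..<b}. g x = d + primitive a b g' x"
    "\<And>x. x \<in> {a..b} \<Longrightarrow> cont_rep a b g x = d + primitive a b g' x"
    using H1_representation[OF \<open>a < b\<close> g] by blast
  note int = f(1,2)[THEN L2_integrable] g(1,2)[THEN L2_integrable]
  note [measurable] = int[THEN borel_measurable_integrable]
  have [measurable]: "primitive a b f' \<in> borel_measurable (lebesgue_on {a<..<b})"
    "primitive a b g' \<in> borel_measurable (lebesgue_on {a<..<b})"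
    using int primitive_continuous by (auto intro!: continuous_borel_measurable_lebesgue_on)
  have int': "integrable (lebesgue_on {a<..<b}) (\<lambda>x. primitive a b f' x * g' x)"
    "integrable (lebesgue_on {a<..<b}) (\<lambda>x. f' x * primitive a b g' x)"
    using integrable_continuous_mult[OF primitive_continuous] int by (auto simp: mult.commute)
  have "(LINT x|lebesgue_on {a<..<b}. f x * g' x) =
        (LINT x|lebesgue_on {a<..<b}. c * g' x + primitive a b f' x * g' x)"
    using c(1) by (intro integral_cong_AE) (auto simp: algebra_simps elim!: eventually_mono)
  moreover have "(LINT x|lebesgue_on {a<..<b}. f' x * g x) =
        (LINT x|lebesgue_on {a<..<b}. d * f' x + f' x * primitive a b g' x)"
    using d(1) by (intro integral_cong_AE) (auto simp: algebra_simps elim!: eventually_mono)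
  ultimately show ?thesis
    using c(2)[of a] c(2)[of b] d(2)[of a] d(2)[of b] \<open>a < b\<close> int int'
      primitive_by_parts[OF int(2) int(4)]
    by (simp add: primitive_left primitive_right algebra_simps)
qed

section \<open>The pairing of curves in $L^2$\<close>

lemma L2_mult_integrable:
  assumes f: "f \<in> L2 a b" and g: "g \<in> L2 a b"
  shows "integrable (lebesgue_on {a<..<b}) (\<lambda>x. f x * g x)"
proof (rule Bochner_Integration.integrable_bound)
  show "integrable (lebesgue_on {a<..<b}) (\<lambda>x. (f x)\<^sup>2 + (g x)\<^sup>2)"
    and "(\<lambda>x. f x * g x) \<in> borel_measurable (lebesgue_on {a<..<b})"
    using f g by (auto simp: L2_def)
  have "\<bar>s * t\<bar> \<le> s\<^sup>2 + t\<^sup>2" for s t :: real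
  proof -
    have "2 * (\<bar>s\<bar> * \<bar>t\<bar>) \<le> s\<^sup>2 + t\<^sup>2" using sum_squares_bound[of "\<bar>s\<bar>" "\<bar>t\<bar>"] by simp
    moreover have "0 \<le> \<bar>s\<bar> * \<bar>t\<bar>" by simp
    ultimately show ?thesis unfolding abs_mult by linarith
  qed
  then show "AE x in lebesgue_on {a<..<b}. norm (f x * g x) \<le> norm ((f x)\<^sup>2 + (g x)\<^sup>2)"
    by (intro AE_I2) simp
qed

lemma L2_linear_comb:
  assumes f: "f \<in> L2 a b" and g: "g \<in> L2 a b"
  shows "(\<lambda>x. c * f x + d * g x) \<in> L2 a b"
proof -
  have "integrable (lebesgue_on {a<..<b}) (\<lambda>x. c\<^sup>2 * (f x)\<^sup>2 + d\<^sup>2 * (g x)\<^sup>2 + 2 * c * d * (f x * g x))"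
    using L2_mult_integrable[OF f g] f g by (auto simp: L2_def)
  also have "(\<lambda>x. c\<^sup>2 * (f x)\<^sup>2 + d\<^sup>2 * (g x)\<^sup>2 + 2 * c * d * (f x * g x)) =
             (\<lambda>x. (c * f x + d * g x)\<^sup>2)"
    by (auto simp: power2_eq_square algebra_simps)
  finally show ?thesis using f g by (auto simp: L2_def)
qed

lemma L2_diff: "f \<in> L2 a b \<Longrightarrow> g \<in> L2 a b \<Longrightarrow> (\<lambda>x. f x - g x) \<in> L2 a b"
  using L2_linear_comb[of f a b g 1 "-1"] by simp

lemma L2_divide: "f \<in> L2 a b \<Longrightarrow> (\<lambda>x. f x / c) \<in> L2 a b"
  using L2_linear_comb[of f a b f "1 / c" 0] by simp

lemma L2_norm_nonneg: "0 \<le> L2_norm a b f"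
  by (simp add: L2_norm_def)

text \<open>The discriminant of the nonnegative quadratic polynomial \<open>s \<mapsto> \<integral> (f + s g)\<^sup>2\<close> is at most 0.\<close>
lemma L2_Cauchy_Schwarz:
  assumes f: "f \<in> L2 a b" and g: "g \<in> L2 a b"
  shows "\<bar>LINT x|lebesgue_on {a<..<b}. f x * g x\<bar> \<le> L2_norm a b f * L2_norm a b g"
proof -
  let ?I = "\<lambda>f. LINT x|lebesgue_on {a<..<b}. f x :: real"
  define A B C where "A = ?I (\<lambda>x. (f x)\<^sup>2)" and "B = ?I (\<lambda>x. f x * g x)" and "C = ?I (\<lambda>x. (g x)\<^sup>2)"
  have int: "integrable (lebesgue_on {a<..<b}) (\<lambda>x. (f x)\<^sup>2)"
    "integrable (lebesgue_on {a<..<b}) (\<lambda>x. (g x)\<^sup>2)"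
    "integrable (lebesgue_on {a<..<b}) (\<lambda>x. f x * g x)"
    using f g L2_mult_integrable[OF f g] by (auto simp: L2_def)
  have quad: "0 \<le> A + 2 * s * B + s\<^sup>2 * C" for s
  proof -
    have "0 \<le> ?I (\<lambda>x. (f x + s * g x)\<^sup>2)" by (rule integral_nonneg_AE) simp
    also have "\<dots> = ?I (\<lambda>x. (f x)\<^sup>2 + 2 * s * (f x * g x) + s\<^sup>2 * (g x)\<^sup>2)"
      by (intro Bochner_Integration.integral_cong) (auto simp: power2_eq_square algebra_simps)
    also have "\<dots> = A + 2 * s * B + s\<^sup>2 * C" using int by (simp add: A_def B_def C_def)
    finally show ?thesis .
  qed
  have "0 \<le> C" unfolding C_def by (rule integral_nonneg_AE) simp
  have "B\<^sup>2 \<le> A * C"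
  proof (cases "C = 0")
    case True
    have "B = 0"
    proof (rule ccontr)
      assume "B \<noteq> 0"
      \<comment> \<open>the polynomial is linear here; this value of \<open>s\<close> makes it equal to \<open>-1\<close>\<close>
      then show False using quad[of "- (A + 1) / (2 * B)"] True by (simp add: field_simps)
    qed
    then show ?thesis using True by simp
  next
    case False
    then have "C > 0" using \<open>0 \<le> C\<close> by simp
    have "0 \<le> C * (A + 2 * (- B / C) * B + (- B / C)\<^sup>2 * C)"
      by (rule mult_nonneg_nonneg[OF \<open>0 \<le> C\<close> quad])
    also have "\<dots> = A * C - B\<^sup>2" using \<open>C > 0\<close> by (simp add: field_simps power2_eq_square)
    finally show ?thesis by simp
  qed
  then have "sqrt (B\<^sup>2) \<le> sqrt (A * C)" by (rule real_sqrt_le_mono)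
  then show ?thesis by (simp add: real_sqrt_mult L2_norm_def A_def B_def C_def)
qed

text \<open>The difference quotient of the pairing minus its claimed limit is a sum of four pairings, each with
  a factor that tends to 0 in \<open>L\<^sup>2\<close> while the other stays bounded; Cauchy-Schwarz concludes.\<close>
lemma L2_inner_has_real_derivative:
  fixes f g :: "real \<Rightarrow> real \<Rightarrow> real"
  assumes t: "t \<in> {t0..t1}"
    and f: "\<And>s. s \<in> {t0..t1} \<Longrightarrow> f s \<in> L2 a b" and g: "\<And>s. s \<in> {t0..t1} \<Longrightarrow> g s \<in> L2 a b"
    and f': "f' \<in> L2 a b" and g': "g' \<in> L2 a b"
    and df: "is_time_deriv t0 t1 a b f t f'" and dg: "is_time_deriv t0 t1 a b g t g'"
    and contf: "((\<lambda>s. L2_norm a b (\<lambda>x. f s x - f t x)) \<longlongrightarrow> 0) (at t within {t0..t1})"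
  shows "((\<lambda>s. LINT x|lebesgue_on {a<..<b}. f s x * g s x) has_real_derivative
           (LINT x|lebesgue_on {a<..<b}. f' x * g t x) + (LINT x|lebesgue_on {a<..<b}. f t x * g' x))
         (at t within {t0..t1})"
proof -
  let ?I = "\<lambda>u v. LINT x|lebesgue_on {a<..<b}. u x * v x :: real"
  let ?N = "L2_norm a b"
  \<comment> \<open>the errors of the difference quotients, and the increment of \<open>f\<close>\<close>
  define Ef where "Ef = (\<lambda>s x. (f s x - f t x) / (s - t) - f' x)"
  define Eg where "Eg = (\<lambda>s x. (g s x - g t x) / (s - t) - g' x)"
  define D where "D = (\<lambda>s x. f s x - f t x)"
  have lim: "((\<lambda>s. ?N (Ef s)) \<longlongrightarrow> 0) (at t within {t0..t1})"
    "((\<lambda>s. ?N (Eg s)) \<longlongrightarrow> 0) (at t within {t0..t1})"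
    "((\<lambda>s. ?N (D s)) \<longlongrightarrow> 0) (at t within {t0..t1})"
    using df dg contf by (auto simp: is_time_deriv_def Ef_def Eg_def D_def)
  let ?L = "?I f' (g t) + ?I (f t) g'"
  have bound: "\<bar>(?I (f s) (g s) - ?I (f t) (g t)) / (s - t) - ?L\<bar> \<le>
      ?N (Ef s) * ?N (g t) + ?N (D s) * ?N (Eg s) + ?N (D s) * ?N g' + ?N (f t) * ?N (Eg s)"
    if s: "s \<in> {t0..t1}" "s \<noteq> t" for s
  proof -
    have L2: "f s \<in> L2 a b" "f t \<in> L2 a b" "g s \<in> L2 a b" "g t \<in> L2 a b"
      using f g s t by auto
    have E: "Ef s \<in> L2 a b" "Eg s \<in> L2 a b" "D s \<in> L2 a b"
      unfolding Ef_def Eg_def D_def by (intro L2_diff L2_divide L2 f' g')+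
    note int = L2_mult_integrable
    have "?I (f s) (g s) = (LINT x|lebesgue_on {a<..<b}. f t x * g t x + (s - t) *
            (f' x * g t x + f t x * g' x +
             (Ef s x * g t x + D s x * Eg s x + D s x * g' x + f t x * Eg s x)))"
    proof (intro Bochner_Integration.integral_cong refl)
      fix x
      have D: "f s x = f t x + D s x" "D s x * g t x = (s - t) * ((f' x + Ef s x) * g t x)"
        "g s x = g t x + (s - t) * (g' x + Eg s x)"
        using s by (simp_all add: D_def Ef_def Eg_def)
      have "f s x * g s x = f t x * g t x + D s x * g t x +
          (s - t) * ((f t x + D s x) * (g' x + Eg s x))"
        unfolding D(1,3) by (simp add: algebra_simps)
      then show "f s x * g s x = f t x * g t x + (s - t) * (f' x * g t x + f t x * g' x +
             (Ef s x * g t x + D s x * Eg s x + D s x * g' x + f t x * Eg s x))"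
        unfolding D(2) by (simp add: algebra_simps)
    qed
    also have "\<dots> = ?I (f t) (g t) + (s - t) * (?L +
        (?I (Ef s) (g t) + ?I (D s) (Eg s) + ?I (D s) g' + ?I (f t) (Eg s)))"
      using int[OF L2(2,4)] int[OF f' L2(4)] int[OF L2(2) g'] int[OF E(1) L2(4)] int[OF E(3,2)]
        int[OF E(3) g'] int[OF L2(2) E(2)] by simp
    finally have "(?I (f s) (g s) - ?I (f t) (g t)) / (s - t) - ?L =
        ?I (Ef s) (g t) + ?I (D s) (Eg s) + ?I (D s) g' + ?I (f t) (Eg s)"
      using s by simp
    then show ?thesis
      using L2_Cauchy_Schwarz[OF E(1) L2(4)] L2_Cauchy_Schwarz[OF E(3,2)]
        L2_Cauchy_Schwarz[OF E(3) g'] L2_Cauchy_Schwarz[OF L2(2) E(2)] by linarith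
  qed
  have "((\<lambda>s. (?I (f s) (g s) - ?I (f t) (g t)) / (s - t) - ?L) \<longlongrightarrow> 0) (at t within {t0..t1})"
  proof (rule Lim_null_comparison)
    show "\<forall>\<^sub>F s in at t within {t0..t1}. norm ((?I (f s) (g s) - ?I (f t) (g t)) / (s - t) - ?L) \<le>
        ?N (Ef s) * ?N (g t) + ?N (D s) * ?N (Eg s) + ?N (D s) * ?N g' + ?N (f t) * ?N (Eg s)"
      unfolding eventually_at_filter real_norm_def
      by (intro always_eventually allI impI) (rule bound)
    have "((\<lambda>s. ?N (Ef s) * ?N (g t) + ?N (D s) * ?N (Eg s) + ?N (D s) * ?N g' + ?N (f t) * ?N (Eg s))
        \<longlongrightarrow> 0 * ?N (g t) + 0 * 0 + 0 * ?N g' + ?N (f t) * 0) (at t within {t0..t1})"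
      by (intro tendsto_intros lim)
    then show "((\<lambda>s. ?N (Ef s) * ?N (g t) + ?N (D s) * ?N (Eg s) + ?N (D s) * ?N g' + ?N (f t) * ?N (Eg s))
        \<longlongrightarrow> 0) (at t within {t0..t1})" by simp
  qed
  then show ?thesis
    by (simp add: has_field_derivative_iff LIM_zero_iff)
qed

section \<open>The scalar equation for the pairing\<close>

lemma time_derivD:
  assumes "f \<in> C1_L2 t0 t1 a b" "t \<in> {t0..t1}"
  shows "f t \<in> L2 a b" "time_deriv t0 t1 a b f t \<in> L2 a b"
    "is_time_deriv t0 t1 a b f t (time_deriv t0 t1 a b f t)"
proof -
  have "\<exists>g. g \<in> L2 a b \<and> is_time_deriv t0 t1 a b f t g" using assms by (auto simp: C1_L2_def)
  from someI_ex[OF this] show "time_deriv t0 t1 a b f t \<in> L2 a b"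
    "is_time_deriv t0 t1 a b f t (time_deriv t0 t1 a b f t)"
    by (auto simp: time_deriv_def)
  show "f t \<in> L2 a b" using assms by (auto simp: C1_L2_def)
qed

lemma weak_derivD:
  assumes "f \<in> H1 a b"
  shows "f \<in> L2 a b" "weak_deriv a b f \<in> L2 a b" "is_weak_deriv a b f (weak_deriv a b f)"
proof -
  have "\<exists>g. g \<in> L2 a b \<and> is_weak_deriv a b f g" using assms by (auto simp: H1_def)
  from someI_ex[OF this] show "weak_deriv a b f \<in> L2 a b"
    "is_weak_deriv a b f (weak_deriv a b f)"
    by (auto simp: weak_deriv_def)
  show "f \<in> L2 a b" using assms by (auto simp: H1_def)
qed

lemma C0_H1_imp_C0_L2: "f \<in> C0_H1 t0 t1 a b \<Longrightarrow> f \<in> C0_L2 t0 t1 a b"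
proof -
  assume f: "f \<in> C0_H1 t0 t1 a b"
  have le: "L2_norm a b h \<le> H1_norm a b h" for h
    by (simp add: H1_norm_def real_le_rsqrt)
  have "((\<lambda>s. L2_norm a b (\<lambda>x. f s x - f t x)) \<longlongrightarrow> 0) (at t within {t0..t1})"
    if "t \<in> {t0..t1}" for t
    by (rule tendsto_sandwich[of "\<lambda>_. 0" _ _ "\<lambda>s. H1_norm a b (\<lambda>x. f s x - f t x)"])
       (use f that le L2_norm_nonneg in \<open>auto simp: C0_H1_def\<close>)
  then show ?thesis using f by (auto simp: C0_H1_def C0_L2_def H1_def)
qed

text \<open>The equation is asked for only in the open interval, because the transport equations say nothing at
  the end times; continuity covers these.\<close>
lemma linear_ode_solution:
  fixes w :: "real \<Rightarrow> real"
  assumes cont: "continuous_on {t0..t1} w"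
    and ode: "\<And>t. t \<in> {t0<..<t1} \<Longrightarrow> (w has_real_derivative lam * w t) (at t)"
    and t: "t \<in> {t0..t1}"
  shows "w t = exp (lam * (t - t0)) * w t0"
proof -
  define v where "v t = exp (- lam * (t - t0)) * w t" for t
  have "v t = v t0"
  proof (cases "t = t0")
    case False
    then have "t0 < t" using t by auto
    then show ?thesis
    proof (rule DERIV_isconst_end)
      show "continuous_on {t0..t} v" unfolding v_def
        using t by (intro continuous_intros continuous_on_subset[OF cont]) auto
      fix s assume "t0 < s" "s < t"
      then have "(w has_real_derivative lam * w s) (at s)" using ode t by auto
      then show "(v has_real_derivative 0) (at s)"
        unfolding v_def by (auto intro!: derivative_eq_intros simp: algebra_simps)
    qed
  qed simp
  then have "exp (lam * (t - t0)) * (exp (- lam * (t - t0)) * w t) = exp (lam * (t - t0)) * w t0"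
    by (simp add: v_def)
  then show ?thesis by (simp add: mult.assoc[symmetric] exp_add[symmetric])
qed

theorem proposition3p5:
  fixes t0 t1 xmin xmax lam z0 :: real
    and G u y z \<psi>0 :: "real \<Rightarrow> real"
    and a \<psi> :: "real \<Rightarrow> real \<Rightarrow> real"
    and T :: "(real \<Rightarrow> real \<Rightarrow> real) \<Rightarrow> real \<Rightarrow> real"
  assumes t_bounds: "0 \<le> t0" "t0 < t1"
    and x_bounds: "0 \<le> xmin" "xmin < xmax"
    and G_cont: "continuous_on {t0..t1} G"
    and G_pos: "\<forall>t\<in>{t0..t1}. G t > 0"
    and \<psi>0_H1: "\<psi>0 \<in> H1 xmin xmax"
    and u_H1: "u \<in> H1 t0 t1"
    and compat: "cont_rep t0 t1 u t0 = cont_rep xmin xmax \<psi>0 xmin"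
    and lam_neg: "lam < 0"
    and a_space: "a \<in> C0_H1 t0 t1 xmin xmax \<inter> C1_L2 t0 t1 xmin xmax"
    and a_pde: "\<forall>t\<in>{t0<..<t1}. AE x in lebesgue_on {xmin<..<xmax}.
          time_deriv t0 t1 xmin xmax a t x + G t * weak_deriv xmin xmax (a t) x
            = lam * a t x + x ^ 3"
    and a_init: "\<forall>x\<in>{xmin..xmax}. cont_rep xmin xmax (a t0) x = 0"
    and a_bdry: "\<forall>t\<in>{t0..t1}. cont_rep xmin xmax (a t) xmin = 0"
    and T_def: "\<forall>\<phi>\<in>C1_L2 t0 t1 xmin xmax. \<forall>t\<in>{t0..t1}.
          T \<phi> t = (LINT x|lebesgue_on {xmin<..<xmax}. a t x * \<phi> t x)"
    and \<psi>_space: "\<psi> \<in> C0_H1 t0 t1 xmin xmax \<inter> C1_L2 t0 t1 xmin xmax"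
    and \<psi>_pde: "\<forall>t\<in>{t0<..<t1}. AE x in lebesgue_on {xmin<..<xmax}.
          time_deriv t0 t1 xmin xmax \<psi> t x = - G t * weak_deriv xmin xmax (\<psi> t) x"
    and \<psi>_init: "\<forall>x\<in>{xmin..xmax}. cont_rep xmin xmax (\<psi> t0) x = cont_rep xmin xmax \<psi>0 x"
    and \<psi>_bdry: "\<forall>t\<in>{t0..t1}. cont_rep xmin xmax (\<psi> t) xmin = cont_rep t0 t1 u t"
    and \<psi>_xmax: "\<forall>t\<in>{t0..t1}. cont_rep xmin xmax (\<psi> t) xmax = 0"
    and y_def: "\<forall>t\<in>{t0..t1}. y t = (LINT x|lebesgue_on {xmin<..<xmax}. \<psi> t x * x ^ 3)"
    and z_ode: "\<forall>t\<in>{t0..t1}. (z has_real_derivative lam * z t + y t) (at t within {t0..t1})"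
    and z_init: "z t0 = z0"
  shows "\<forall>t\<in>{t0..t1}. T \<psi> t - z t = exp (lam * (t - t0)) * (T \<psi> t0 - z0)"
proof -
  let ?I = "\<lambda>u v. LINT x|lebesgue_on {xmin<..<xmax}. u x * v x :: real"
  let ?a' = "time_deriv t0 t1 xmin xmax a" and ?\<psi>' = "time_deriv t0 t1 xmin xmax \<psi>"
  let ?ax = "\<lambda>t. weak_deriv xmin xmax (a t)" and ?\<psi>x = "\<lambda>t. weak_deriv xmin xmax (\<psi> t)"
  note at = time_derivD[OF IntD2[OF a_space]] and \<psi>t = time_derivD[OF IntD2[OF \<psi>_space]]
  have H1: "a t \<in> H1 xmin xmax" "\<psi> t \<in> H1 xmin xmax" if "t \<in> {t0..t1}" for t
    using a_space \<psi>_space that by (auto simp: C0_H1_def)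
  have T_eq: "T \<psi> t = ?I (a t) (\<psi> t)" if "t \<in> {t0..t1}" for t
    using T_def \<psi>_space that by blast
  have T_deriv: "(T \<psi> has_real_derivative ?I (?a' t) (\<psi> t) + ?I (a t) (?\<psi>' t)) (at t within {t0..t1})"
    if t: "t \<in> {t0..t1}" for t
  proof (rule has_field_derivative_transform_within[OF _ zero_less_one t])
    show "((\<lambda>s. ?I (a s) (\<psi> s)) has_real_derivative ?I (?a' t) (\<psi> t) + ?I (a t) (?\<psi>' t))
        (at t within {t0..t1})"
      using C0_H1_imp_C0_L2[OF IntD1[OF a_space]] t
      by (intro L2_inner_has_real_derivative at \<psi>t) (auto simp: C0_L2_def)
  qed (use T_eq in auto)
  have T_ode: "?I (?a' t) (\<psi> t) + ?I (a t) (?\<psi>' t) = lam * T \<psi> t + y t" if t: "t \<in> {t0<..<t1}" for t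
  proof -
    have t': "t \<in> {t0..t1}" using t by auto
    note aw = weak_derivD[OF H1(1)[OF t']] and \<psi>w = weak_derivD[OF H1(2)[OF t']]
    have cube: "(\<lambda>x. x ^ 3) \<in> L2 xmin xmax"
      unfolding L2_def
      by (auto intro!: continuous_borel_measurable_lebesgue_on continuous_integrable_lebesgue_on
          continuous_intros)
    note L2 = aw(1,2) \<psi>w(1,2) at(2)[OF t'] \<psi>t(2)[OF t'] cube
    note [measurable] = L2[THEN L2_integrable, THEN borel_measurable_integrable]
    \<comment> \<open>the equation of \<open>a\<close>; its source term yields \<open>y\<close>\<close>
    have "?I (?a' t) (\<psi> t) = (LINT x|lebesgue_on {xmin<..<xmax}.
        lam * (a t x * \<psi> t x) + \<psi> t x * x ^ 3 - G t * (?ax t x * \<psi> t x))"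
    proof (rule integral_cong_AE)
      show "AE x in lebesgue_on {xmin<..<xmax}. ?a' t x * \<psi> t x =
          lam * (a t x * \<psi> t x) + \<psi> t x * x ^ 3 - G t * (?ax t x * \<psi> t x)"
        using a_pde[rule_format, OF t]
      proof eventually_elim
        case (elim x)
        then have "?a' t x = lam * a t x + x ^ 3 - G t * ?ax t x" by simp
        then show ?case by (simp only:) (simp add: algebra_simps)
      qed
    qed measurable
    also have "\<dots> = lam * ?I (a t) (\<psi> t) + y t - G t * ?I (?ax t) (\<psi> t)"
      using L2_mult_integrable[OF L2(1,3)] L2_mult_integrable[OF L2(3) cube]
        L2_mult_integrable[OF L2(2,3)] y_def t' by simp
    finally have 1: "?I (?a' t) (\<psi> t) = lam * T \<psi> t + y t - G t * ?I (?ax t) (\<psi> t)"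
      using T_eq[OF t'] by simp
    have "?I (a t) (?\<psi>' t) = (LINT x|lebesgue_on {xmin<..<xmax}. - G t * (a t x * ?\<psi>x t x))"
    proof (rule integral_cong_AE)
      show "AE x in lebesgue_on {xmin<..<xmax}. a t x * ?\<psi>' t x = - G t * (a t x * ?\<psi>x t x)"
        using \<psi>_pde[rule_format, OF t] by eventually_elim simp
    qed measurable
    then have 2: "?I (a t) (?\<psi>' t) = - G t * ?I (a t) (?\<psi>x t)" by simp
    \<comment> \<open>the boundary term: \<open>a\<close> vanishes at \<open>xmin\<close>, \<open>\<psi>\<close> at \<open>xmax\<close>\<close>
    have "?I (a t) (?\<psi>x t) + ?I (?ax t) (\<psi> t) = 0"
      using H1_integration_by_parts[OF x_bounds(2) aw \<psi>w] a_bdry \<psi>_xmax t' by simp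
    then have "G t * (?I (a t) (?\<psi>x t) + ?I (?ax t) (\<psi> t)) = 0" by simp
    then show ?thesis unfolding 1 2 by (simp add: distrib_left)
  qed
  define w where "w t = T \<psi> t - z t" for t
  have w_deriv: "(w has_real_derivative
      (?I (?a' t) (\<psi> t) + ?I (a t) (?\<psi>' t)) - (lam * z t + y t)) (at t within {t0..t1})"
    if "t \<in> {t0..t1}" for t
    unfolding w_def using T_deriv[OF that] z_ode that by (intro DERIV_diff) auto
  have "w t = exp (lam * (t - t0)) * w t0" if "t \<in> {t0..t1}" for t
  proof (rule linear_ode_solution[OF _ _ that])
    show "continuous_on {t0..t1} w"
      using w_deriv DERIV_continuous continuous_on_eq_continuous_within by blast
    fix t assume t: "t \<in> {t0<..<t1}"
    then have "(w has_real_derivative lam * w t) (at t within {t0..t1})"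
      using w_deriv[of t] T_ode[OF t] by (simp add: w_def algebra_simps)
    then show "(w has_real_derivative lam * w t) (at t)"
      using t by (simp add: at_within_Icc_at)
  qed
  then show ?thesis using z_init by (simp add: w_def)
qed

end
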